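(* Let $F$ be the random map associated with a finite collection $\{T_1,\dots,T_N\}$ of good and bad maps containing at least one good and at least one bad map, and with a strictly positive probability vector $\mathbf p=(p_j)_{j\in\Sigma}$. Let $\theta=\sum_{b\in\Sigma_B}p_b\ell_b$. If $\theta\ge 1$, then $F$ admits no acs probability measure.
   Context: A map $T_g:[0,1]\to[0,1]$ is called good if, for some $r_g\ge 1$, $T_g(x)=1-2^{r_g}(\frac12-x)^{r_g}$ for $x\in[0,\frac12)$ and $T_g(x)=2x-1$ for $x\in[\frac12,1]$. A map $T_b:[0,1]\to[0,1]$ is called bad if, for some $\ell_b>1$, $T_b(x)=\frac12-2^{\ell_b-1}(\frac12-x)^{\ell_b}$ for $x\in[0,\frac12)$ and $T_b(x)=2x-1$ for $x\in[\frac12,1]$. For a finite collection $T_1,\dots,T_N$ of good and bad maps put $\Sigma=\{1,\dots,N\}$, $\Sigma_G=\{j: T_j\text{ is good}\}$, $\Sigma_B=\{j:T_j\text{ is bad}\}$; both $\Sigma_G$ and $\Sigma_B$ are assumed nonempty. The parameter of $T_g$ ($g\in\Sigma_G$) is $r_g$ and that of $T_b$ ($b\in\Sigma_B$) is $\ell_b$. The random map is $F:\Sigma^{\mathbb N}\times[0,1]\to\Sigma^{\mathbb N}\times[0,1]$, $F(\omega,x)=(\sigma\omega,T_{\omega_1}(x))$, with $\sigma$ the left shift. $\lambda$ is Lebesgue measure on $[0,1]$. Given a probability vector $\mathbf p=(p_j)_{j\in\Sigma}$ with strictly positive entries, an acs (absolutely continuous stationary) measure for $F$ is a Borel measure $\mu$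 on $[0,1]$ that is absolutely continuous with respect to $\lambda$ and satisfies $\sum_{j\in\Sigma}p_j\mu(T_j^{-1}A)=\mu(A)$ for all Borel sets $A\subseteq[0,1]$. *)

theory Defs
  imports "HOL-Probability.Probability"
begin

text \<open>A self-map of \<open>[0,1]\<close> is a function \<open>real \<Rightarrow> real\<close> of which only the values
  on \<open>{0..1}\<close> matter.\<close>

definition good_map_with :: "real \<Rightarrow> (real \<Rightarrow> real) \<Rightarrow> bool" where
  "good_map_with r T \<longleftrightarrow> r \<ge> 1 \<and>
     (\<forall>x\<in>{0..<1/2}. T x = 1 - 2 powr r * (1/2 - x) powr r) \<and>
     (\<forall>x\<in>{1/2..1}. T x = 2 * x - 1)"

definition bad_map_with :: "real \<Rightarrow> (real \<Rightarrow> real) \<Rightarrow> bool" where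
  "bad_map_with l T \<longleftrightarrow> l > 1 \<and>
     (\<forall>x\<in>{0..<1/2}. T x = 1/2 - 2 powr (l - 1) * (1/2 - x) powr l) \<and>
     (\<forall>x\<in>{1/2..1}. T x = 2 * x - 1)"

definition good_map :: "(real \<Rightarrow> real) \<Rightarrow> bool" where
  "good_map T \<longleftrightarrow> (\<exists>r. good_map_with r T)"

definition bad_map :: "(real \<Rightarrow> real) \<Rightarrow> bool" where
  "bad_map T \<longleftrightarrow> (\<exists>l. bad_map_with l T)"

definition good_indices :: "nat \<Rightarrow> (nat \<Rightarrow> real \<Rightarrow> real) \<Rightarrow> nat set" where
  "good_indices N T = {j\<in>{1..N}. good_map (T j)}"

definition bad_indices :: "nat \<Rightarrow> (nat \<Rightarrow> real \<Rightarrow> real) \<Rightarrow> nat set" where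
  "bad_indices N T = {j\<in>{1..N}. bad_map (T j)}"

text \<open>Stationarity of a measure for the random map
  \<open>F (\<omega>, x) = (\<sigma> \<omega>, T (\<omega> 1) x)\<close> involves only the maps \<open>T\<^sub>1, \<dots>, T\<^sub>N\<close>
  and the weights \<open>p\<close>, so these data stand for \<open>F\<close>. Here \<open>\<mu>\<close> is a Borel measure on
  the space \<open>{0..1}\<close> (not on the whole line); it need not be finite.\<close>

definition acs_measure ::
  "nat \<Rightarrow> (nat \<Rightarrow> real \<Rightarrow> real) \<Rightarrow> (nat \<Rightarrow> real) \<Rightarrow> real measure \<Rightarrow> bool" where
  "acs_measure N T p \<mu> \<longleftrightarrow>
     sets \<mu> = sets (restrict_space borel {0..1}) \<and>
     absolutely_continuous (restrict_space lborel {0..1}) \<mu> \<and>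
     (\<forall>A\<in>sets (restrict_space borel {0..1}).
        (\<Sum>j\<in>{1..N}. ennreal (p j) * emeasure \<mu> (T j -` A \<inter> {0..1})) = emeasure \<mu> A)"

lemma bad_map_with_unique:
  assumes "bad_map_with l T" "bad_map_with l' T"
  shows "l = l'"
proof -
  have *: "T (1/4) = 1/2 - 2 powr (- k - 1)" if "bad_map_with k T" for k :: real
  proof -
    have "(1/4::real) powr k = 2 powr (- (2 * k))"
    proof -
      have e: "2 powr (-2) = (1/4::real)" by (simp add: powr_minus)
      have "(1/4::real) powr k = (2 powr (-2)) powr k" by (simp only: e)
      also have "\<dots> = 2 powr (-2 * k)" by (rule powr_powr)
      finally show ?thesis by simp
    qed
    then have "2 powr (k - 1) * (1/4::real) powr k = 2 powr (- k - 1)"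
      by (simp flip: powr_add)
    then show ?thesis using that by (simp add: bad_map_with_def)
  qed
  from *[OF assms(1)] *[OF assms(2)] have "(2::real) powr (- l - 1) = 2 powr (- l' - 1)"
    by simp
  then have "- l - 1 = - l' - 1" by (subst (asm) powr_inj) auto
  then show ?thesis by simp
qed

lemma good_indices_Int_bad_indices: "good_indices N T \<inter> bad_indices N T = {}"
proof -
  have False if "good_map_with r S" "bad_map_with l S" for r l :: real and S
  proof -
    have "2 powr r * (1/4::real) powr r = (1/2) powr r"
      by (simp flip: powr_mult)
    moreover have "(1/2::real) powr r \<le> (1/2) powr 1"
      using that(1) by (intro powr_mono') (auto simp: good_map_with_def)
    ultimately have "S (1/4) \<ge> 1/2" using that(1) by (simp add: good_map_with_def)
    moreover have "S (1/4) < 1/2" using that(2) by (simp add: bad_map_with_def)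
    ultimately show False by simp
  qed
  then show ?thesis
    by (auto simp: good_indices_def bad_indices_def good_map_def bad_map_def)
qed

end

theory Submission
  imports Defs
begin

text \<open>
  The coordinate \<open>u x = - ln (1 - 2 x)\<close> on \<open>[0,1/2)\<close>, extended by \<open>0\<close>, is multiplied by
  \<open>\<ell>\<^sub>b\<close> under a bad map. A point of \<open>[0,1/2)\<close> that is moved by a good map needs a time proportional
  to \<open>u\<close> to come back from the repelling fixed point \<open>1\<close>; hence \<open>u\<close> is integrable for a stationary
  probability \<open>\<mu>\<close> (the drift of \<open>- ln (1 - x)\<close>, truncated, makes this precise). Since
  \<open>\<theta> \<ge> 1\<close>, stationarity then bounds \<open>\<integral> u d\<mu>\<close> from below by itself plus the amount of \<open>u\<close>
  that is created on \<open>[1/2,1]\<close> and by a good map. So nothing is created: almost no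
  orbit leaves \<open>[1/2,1]\<close> through \<open>(1/2,3/4)\<close>, whereas \<open>x \<mapsto> 2 x - 1\<close> forces every orbit
  in \<open>(1/2,1)\<close> to leave.
\<close>

section \<open>The logarithmic coordinate and the branches of the maps\<close>

definition left_log :: "real \<Rightarrow> real" where
  "left_log x = (if x < 1/2 then - ln (1 - 2 * x) else 0)"

lemma left_log_nonneg: "0 \<le> x \<Longrightarrow> 0 \<le> left_log x"
  by (simp add: left_log_def)

lemma left_log_eq_0: "0 \<le> x \<Longrightarrow> left_log x = 0 \<Longrightarrow> x = 0 \<or> 1/2 \<le> x"
  by (auto simp: left_log_def split: if_splits)

lemma left_log_measurable [measurable]: "left_log \<in> borel_measurable borel"
  unfolding left_log_def by measurable

lemma powr_scaled_half:
  fixes x a :: real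
  assumes "x < 1/2"
  shows "2 powr a * (1/2 - x) powr a = (1 - 2 * x) powr a"
  using assms powr_mult[of 2 "1/2 - x" a] by (simp add: algebra_simps)

lemma good_map_left:
  assumes "good_map_with r S" "x \<in> {0..<1/2}"
  shows "S x = 1 - (1 - 2 * x) powr r"
  using assms powr_scaled_half[of x r] by (simp add: good_map_with_def)

lemma bad_map_left:
  assumes "bad_map_with k S" "x \<in> {0..<1/2}"
  shows "S x = (1 - (1 - 2 * x) powr k) / 2"
proof -
  have "2 * (2 powr (k - 1) * (1/2 - x) powr k) = (1 - 2 * x) powr k"
    using assms(2) powr_scaled_half[of x k] by (simp add: powr_diff)
  then show ?thesis
    using assms by (simp add: bad_map_with_def)
qed

lemma map_right:
  assumes "good_map S \<or> bad_map S" "x \<in> {1/2..1}"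
  shows "S x = 2 * x - 1"
  using assms by (auto simp: good_map_def bad_map_def good_map_with_def bad_map_with_def)

lemma powr_unit_interval:
  fixes x a :: real
  assumes "x \<in> {0..<1/2}" "0 < a"
  shows "0 < (1 - 2 * x) powr a" "(1 - 2 * x) powr a \<le> 1"
  using assms by (auto intro: powr_le1)

lemma map_in_unit:
  assumes "good_map S \<or> bad_map S" "x \<in> {0..1}"
  shows "S x \<in> {0..1}"
proof (cases "x < 1/2")
  case True
  then have x: "x \<in> {0..<1/2}" using assms by auto
  from assms(1) consider r where "good_map_with r S" | k where "bad_map_with k S"
    by (auto simp: good_map_def bad_map_def)
  then show ?thesis
  proof cases
    case (1 r)
    then have "0 < r" by (simp add: good_map_with_def)
    then show ?thesis using good_map_left[OF 1 x] powr_unit_interval[OF x, of r] by simp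
  next
    case (2 k)
    then have "0 < k" by (simp add: bad_map_with_def)
    then show ?thesis using bad_map_left[OF 2 x] powr_unit_interval[OF x, of k] by (simp del: powr_gt_zero)
  qed
next
  case False
  then show ?thesis using assms map_right[of S x] by simp
qed

lemma map_measurable:
  assumes "good_map S \<or> bad_map S"
  shows "S \<in> restrict_space borel {0..1} \<rightarrow>\<^sub>M restrict_space borel {0..1}"
proof -
  \<comment> \<open>The map \<open>S\<close> is prescribed only on [0,1] and may be arbitrary
    elsewhere. \<open>f r\<close> and \<open>h k\<close> are Borel on the whole line and agree on
    [0,1] with a good and a bad map respectively.\<close>
  define f where
    "f r x = (if x < 1/2 then 1 - (1 - 2 * x) powr r else 2 * x - 1)" for r x :: real
  define h where
    "h k x = (if x < 1/2 then (1 - (1 - 2 * x) powr k) / 2 else 2 * x - 1)" for k x :: real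
  have [measurable]: "f r \<in> borel_measurable borel" "h r \<in> borel_measurable borel" for r
    unfolding f_def h_def by measurable
  have "\<exists>f\<in>borel_measurable borel. \<forall>x\<in>{0..1}. S x = f x"
  proof -
    from assms consider r where "good_map_with r S" | k where "bad_map_with k S"
      by (auto simp: good_map_def bad_map_def)
    then show ?thesis
    proof cases
      case (1 r)
      then show ?thesis
        using good_map_left[OF 1] map_right[OF assms]
        by (intro bexI[of _ "f r"]) (auto simp: f_def)
    next
      case (2 k)
      then show ?thesis
        using bad_map_left[OF 2] map_right[OF assms]
        by (intro bexI[of _ "h k"]) (auto simp: h_def)
    qed
  qed
  then obtain q where q: "q \<in> borel_measurable borel" "\<And>x. x \<in> {0..1} \<Longrightarrow> S x = q x"
    by blast
  have "S \<in> borel_measurable (restrict_space borel {0..1})"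
    using q measurable_restrict_space1[OF q(1), of "{0..1}"]
    by (subst measurable_cong[where g = q]) (auto simp: space_restrict_space)
  then show ?thesis
    using map_in_unit[OF assms]
    by (intro measurable_restrict_space2) (auto simp: space_restrict_space)
qed

text \<open>The left branch raises 1 - 2 x to the power \<open>k\<close>, so the logarithm is
  multiplied by \<open>k\<close>. The power is positive, hence the image stays in [0,1/2) and is
  again measured by the first case of \<open>left_log\<close>.\<close>

lemma left_log_bad_map:
  assumes "bad_map_with k S" "x \<in> {0..<1/2}"
  shows "left_log (S x) = k * left_log x"
proof -
  have "0 < k" using assms by (simp add: bad_map_with_def)
  then have "0 < (1 - 2 * x) powr k" using powr_unit_interval[OF assms(2)] by simp
  moreover have S: "1 - 2 * S x = (1 - 2 * x) powr k" using bad_map_left[OF assms] by simp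
  ultimately have "S x < 1/2" by linarith
  with S show ?thesis
    using assms(2) by (simp add: left_log_def ln_powr)
qed

text \<open>Here 1 - \<open>S x\<close> is the \<open>r\<close>-th power of 1 - 2 x, so the
  right-hand side equals \<open>r * left_log x\<close>, and \<open>r\<close> is at least 1. Points
  near 1/2 thus land close to the fixed point 1.\<close>

lemma ln_good_map:
  assumes "good_map_with r S" "x \<in> {0..<1/2}"
  shows "left_log x \<le> - ln (1 - S x)"
proof -
  have "1 \<le> r" using assms by (simp add: good_map_with_def)
  then have "1 * left_log x \<le> r * left_log x"
    using assms left_log_nonneg by (intro mult_right_mono) auto
  also have "\<dots> = - ln (1 - S x)"
    using assms good_map_left[OF assms] by (simp add: left_log_def ln_powr)
  finally show ?thesis by simp
qed

lemma neg_ln_left: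
  fixes x :: real
  assumes "x < 1/2"
  shows "- ln (1 - x) \<le> 1"
proof -
  have "ln (1/2) \<le> ln (1 - x)" using assms by simp
  then show ?thesis using ln_le_minus_one[of "2::real"] by (simp add: ln_div)
qed

text \<open>At \<open>x = 1\<close> the junk value \<open>ln 0 = 0\<close> is harmless, because \<open>1\<close> is a fixed point.\<close>

lemma neg_ln_drift:
  assumes "good_map S \<or> bad_map S" "x \<in> {0..1}"
  shows "- ln (1 - x) \<le> - ln (1 - S x) + 1"
proof (cases "x < 1/2")
  case True
  have "- ln (1 - x) \<le> 1" by (rule neg_ln_left[OF True])
  moreover have "0 \<le> - ln (1 - S x)"
    using map_in_unit[OF assms] by (cases "S x = 1") auto
  ultimately show ?thesis by simp
next
  case False
  \<comment> \<open>The distance to 1 doubles, so - ln (1 - x) drops by exactly ln 2, which is at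
    most 1.\<close>
  then have S: "1 - S x = 2 * (1 - x)" using assms map_right[of S x] by simp
  show ?thesis
  proof (cases "x = 1")
    case False
    then have "ln (1 - S x) = ln 2 + ln (1 - x)"
      using S assms by (simp add: ln_mult del: right_diff_distrib_numeral)
    then show ?thesis using ln_le_minus_one[of "2::real"] by simp
  qed (use S in simp)
qed

section \<open>Stationarity for integrals and for null sets\<close>

text \<open>Stationarity is the case of indicator functions; linearity and monotone convergence
  carry it to all nonnegative functions.\<close>

lemma nn_integral_stationary:
  fixes p :: "'i \<Rightarrow> ennreal"
  assumes T: "\<And>j. j \<in> J \<Longrightarrow> T j \<in> M \<rightarrow>\<^sub>M M"
    and stat: "\<And>A. A \<in> sets M \<Longrightarrow> (\<Sum>j\<in>J. p j * emeasure M (T j -` A \<inter> space M)) = emeasure M A"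
    and h: "h \<in> borel_measurable M"
  shows "(\<Sum>j\<in>J. p j * (\<integral>\<^sup>+x. h (T j x) \<partial>M)) = (\<integral>\<^sup>+x. h x \<partial>M)"
proof -
  \<comment> \<open>With push-forward measures the induction acts on the integrand \<open>h\<close>
    itself and not on the composites with \<open>T j\<close>.\<close>
  let ?D = "\<lambda>j. distr M M (T j)"
  have "(\<Sum>j\<in>J. p j * (\<integral>\<^sup>+x. h x \<partial>?D j)) = (\<integral>\<^sup>+x. h x \<partial>M)"
    using h
  proof (induction rule: borel_measurable_induct)
    case (cong f g)
    then have "(\<integral>\<^sup>+x. f x \<partial>?D j) = (\<integral>\<^sup>+x. g x \<partial>?D j)" "(\<integral>\<^sup>+x. f x \<partial>M) = (\<integral>\<^sup>+x. g x \<partial>M)" for j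
      by (auto intro!: nn_integral_cong)
    then show ?case using cong by simp
  next
    case (set A)
    then show ?case using stat[OF set] T by (simp add: emeasure_distr)
  next
    case (mult u c)
    then show ?case
      by (simp add: nn_integral_cmult mult.left_commute flip: sum_distrib_left)
  next
    case (add u v)
    then show ?case
      by (simp add: nn_integral_add distrib_left sum.distrib)
  next
    case (seq U)
    have inc: "incseq (\<lambda>i. p j * (\<integral>\<^sup>+x. U i x \<partial>?D j))" for j
      using seq(3) by (intro incseq_SucI mult_left_mono nn_integral_mono)
        (auto simp: incseq_Suc_iff le_fun_def)
    have "(\<Sum>j\<in>J. p j * (\<integral>\<^sup>+x. (SUP i. U i) x \<partial>?D j))
        = (\<Sum>j\<in>J. SUP i. p j * (\<integral>\<^sup>+x. U i x \<partial>?D j))"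
      using seq by (simp add: image_comp nn_integral_monotone_convergence_SUP SUP_mult_left_ennreal)
    also have "\<dots> = (SUP i. \<Sum>j\<in>J. p j * (\<integral>\<^sup>+x. U i x \<partial>?D j))"
      using inc by (intro ennreal_SUP_sum[symmetric]) auto
    also have "\<dots> = (\<integral>\<^sup>+x. (SUP i. U i) x \<partial>M)"
      using seq by (simp add: image_comp nn_integral_monotone_convergence_SUP)
    finally show ?case by (simp add: image_comp)
  qed
  then show ?thesis using T h by (simp add: nn_integral_distr)
qed

text \<open>With the average inside the integral, pointwise drift inequalities can be integrated
  directly.\<close>

lemma nn_integral_stationary_real:
  fixes p :: "'i \<Rightarrow> real" and h :: "'a \<Rightarrow> real"
  assumes T: "\<And>j. j \<in> J \<Longrightarrow> T j \<in> M \<rightarrow>\<^sub>M M"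
    and stat: "\<And>A. A \<in> sets M \<Longrightarrow>
      (\<Sum>j\<in>J. ennreal (p j) * emeasure M (T j -` A \<inter> space M)) = emeasure M A"
    and p: "\<And>j. j \<in> J \<Longrightarrow> 0 \<le> p j"
    and h: "h \<in> borel_measurable M" and h0: "\<And>x. x \<in> space M \<Longrightarrow> 0 \<le> h x"
  shows "(\<integral>\<^sup>+x. (\<Sum>j\<in>J. p j * h (T j x)) \<partial>M) = (\<integral>\<^sup>+x. h x \<partial>M)"
proof -
  have [measurable]: "(\<lambda>x. h (T j x)) \<in> borel_measurable M" if "j \<in> J" for j
    using measurable_compose[OF T[OF that] h] .
  have "(\<integral>\<^sup>+x. (\<Sum>j\<in>J. p j * h (T j x)) \<partial>M) = (\<integral>\<^sup>+x. (\<Sum>j\<in>J. ennreal (p j) * ennreal (h (T j x))) \<partial>M)"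
    using p h0 measurable_space[OF T]
    by (intro nn_integral_cong) (simp add: ennreal_mult flip: sum_ennreal)
  also have "\<dots> = (\<Sum>j\<in>J. ennreal (p j) * (\<integral>\<^sup>+x. h (T j x) \<partial>M))"
    by (simp add: nn_integral_sum nn_integral_cmult)
  also have "\<dots> = (\<integral>\<^sup>+x. h x \<partial>M)"
    using T stat h by (intro nn_integral_stationary) auto
  finally show ?thesis .
qed

text \<open>If \<open>A\<close> is null, every summand of the stationarity identity vanishes; as
  \<open>p g\<close> is positive, the preimage of \<open>A\<close> under \<open>T g\<close> is
  null.\<close>

lemma AE_stationary:
  fixes p :: "'i \<Rightarrow> real"
  assumes "finite J" "g \<in> J" "0 < p g" "T g \<in> M \<rightarrow>\<^sub>M M"
    and stat: "\<And>A. A \<in> sets M \<Longrightarrow>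
      (\<Sum>j\<in>J. ennreal (p j) * emeasure M (T j -` A \<inter> space M)) = emeasure M A"
    and P: "AE x in M. P x"
  shows "AE x in M. P (T g x)"
proof -
  obtain A where A: "{x \<in> space M. \<not> P x} \<subseteq> A" "A \<in> sets M" "emeasure M A = 0"
    using P by (auto elim: AE_E)
  have "ennreal (p g) * emeasure M (T g -` A \<inter> space M) = 0"
    using stat[OF A(2)] A(3) assms(1,2) by simp
  then have "T g -` A \<inter> space M \<in> null_sets M"
    using assms(3,4) A(2) by (auto simp: null_sets_def measurable_sets)
  then show ?thesis
    using A(1) measurable_space[OF assms(4)] by (intro AE_I') auto
qed

section \<open>Integrability of the coordinate, absence of gain, and the contradiction\<close>

lemma unit_measure_not_stationary:
  fixes M :: "real measure"
  assumes "prob_space M"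
    and sp: "sets M = sets (restrict_space borel {0..1})"
    and ac: "absolutely_continuous (restrict_space lborel {0..1}) M"
    and maps: "\<forall>j\<in>{1..N}. good_map (T j) \<or> bad_map (T j)"
    and g: "g \<in> good_indices N T"
    and l: "\<forall>b\<in>bad_indices N T. bad_map_with (l b) (T b)"
    and p: "\<forall>j\<in>{1..N}. p j > 0" and p1: "(\<Sum>j\<in>{1..N}. p j) = 1"
    and \<theta>: "1 \<le> (\<Sum>b\<in>bad_indices N T. p b * l b)"
    and stat: "\<And>A. A \<in> sets M \<Longrightarrow>
      (\<Sum>j\<in>{1..N}. ennreal (p j) * emeasure M (T j -` A \<inter> space M)) = emeasure M A"
  shows False
proof -
  interpret prob_space M by fact
  have space: "space M = {0..1}"
    using sets_eq_imp_space_eq[OF sp] by (simp add: space_restrict_space)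
  have T: "T j \<in> M \<rightarrow>\<^sub>M M" if "j \<in> {1..N}" for j
    using map_measurable[of "T j"] maps that measurable_cong_sets[OF sp sp] by auto
  have borelM: "f \<in> borel_measurable M" if "f \<in> borel_measurable borel" for f :: "real \<Rightarrow> real"
    using measurable_restrict_space1[OF that, of "{0..1}"] measurable_cong_sets[OF sp refl] by auto
  have [measurable]: "left_log \<in> borel_measurable M"
    by (intro borelM) simp
  obtain r where r: "good_map_with r (T g)" and gN: "g \<in> {1..N}"
    using g by (auto simp: good_indices_def good_map_def)
  have pg: "0 < p g" using p gN by simp
  have [measurable]: "T g \<in> M \<rightarrow>\<^sub>M M" using T gN by simp

  \<comment> \<open>The truncation at \<open>n\<close> makes the integral finite, so that it can be
    cancelled after integrating the drift inequality.\<close>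
  define \<phi> :: "nat \<Rightarrow> real \<Rightarrow> real" where "\<phi> n x = min (real n) (- ln (1 - x))" for n x
  have \<phi>_meas [measurable]: "\<phi> n \<in> borel_measurable M" for n
    unfolding \<phi>_def by (intro borelM) simp
  have \<phi>_nonneg: "0 \<le> \<phi> n x" if "x \<in> {0..1}" for n x
    using that by (cases "x = 1") (auto simp: \<phi>_def)
  have bound: "(\<integral>\<^sup>+x. p g * min (real n) (left_log x) \<partial>M) \<le> 1" for n
  proof -
    have fin: "(\<integral>\<^sup>+x. \<phi> n x \<partial>M) < \<infinity>"
    proof -
      have "(\<integral>\<^sup>+x. \<phi> n x \<partial>M) \<le> (\<integral>\<^sup>+x. ennreal (real n) \<partial>M)"
        by (intro nn_integral_mono ennreal_leI) (simp add: \<phi>_def)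
      also have "\<dots> < \<infinity>" by (simp add: emeasure_space_1)
      finally show ?thesis .
    qed
    have drift: "\<phi> n x + p g * min (real n) (left_log x) \<le> (\<Sum>j\<in>{1..N}. p j * \<phi> n (T j x)) + 1"
      if x: "x \<in> {0..1}" for x
    proof -
      \<comment> \<open>The extra term occurs only for \<open>T g\<close> on the left half, where
        \<open>\<phi> n x\<close> is at most 1 and \<open>\<phi> n (T g x)\<close> dominates it.
        Otherwise \<open>neg_ln_drift\<close> suffices, since truncation preserves it.\<close>
      have *: "\<phi> n x + (if j = g then min (real n) (left_log x) else 0) \<le> \<phi> n (T j x) + 1"
        if j: "j \<in> {1..N}" for j
      proof (cases "j = g \<and> x < 1/2")
        case True
        then have "- ln (1 - x) \<le> 1"
          by (intro neg_ln_left) simp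
        moreover have "left_log x \<le> - ln (1 - T j x)"
          using True x r by (intro ln_good_map) auto
        ultimately show ?thesis using True by (auto simp: \<phi>_def)
      next
        case False
        then have "(if j = g then min (real n) (left_log x) else 0) = 0"
          by (auto simp: left_log_def)
        then show ?thesis
          using neg_ln_drift[of "T j" x] maps j x by (auto simp: \<phi>_def)
      qed
      have "\<phi> n x + p g * min (real n) (left_log x)
          = (\<Sum>j\<in>{1..N}. p j * (\<phi> n x + (if j = g then min (real n) (left_log x) else 0)))"
        using gN p1 by (simp only: distrib_left sum.distrib flip: sum_distrib_right)
          (simp add: if_distrib cong: if_cong)
      also have "\<dots> \<le> (\<Sum>j\<in>{1..N}. p j * (\<phi> n (T j x) + 1))"
        using * p by (intro sum_mono mult_left_mono) (auto intro: less_imp_le)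
      also have "\<dots> = (\<Sum>j\<in>{1..N}. p j * \<phi> n (T j x)) + 1"
        using p1 by (simp add: distrib_left sum.distrib)
      finally show ?thesis .
    qed
    have [measurable]: "(\<lambda>x. \<phi> n (T j x)) \<in> borel_measurable M" if "j \<in> {1..N}" for j
      by (rule measurable_compose[OF T[OF that]]) simp
    have "(\<integral>\<^sup>+x. \<phi> n x \<partial>M) + (\<integral>\<^sup>+x. p g * min (real n) (left_log x) \<partial>M)
        = (\<integral>\<^sup>+x. ennreal (\<phi> n x) + ennreal (p g * min (real n) (left_log x)) \<partial>M)"
      by (intro nn_integral_add[symmetric]) measurable
    also have "\<dots> \<le> (\<integral>\<^sup>+x. ennreal (\<Sum>j\<in>{1..N}. p j * \<phi> n (T j x)) + 1 \<partial>M)"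
    proof (intro nn_integral_mono)
      fix x assume "x \<in> space M"
      then have x: "x \<in> {0..1}" by (simp add: space)
      have "0 \<le> (\<Sum>j\<in>{1..N}. p j * \<phi> n (T j x))"
        using p \<phi>_nonneg map_in_unit maps x by (intro sum_nonneg mult_nonneg_nonneg) (auto intro: less_imp_le)
      moreover have "0 \<le> p g * min (real n) (left_log x)"
        using pg x left_log_nonneg by (simp add: less_imp_le)
      ultimately show "ennreal (\<phi> n x) + ennreal (p g * min (real n) (left_log x))
          \<le> ennreal (\<Sum>j\<in>{1..N}. p j * \<phi> n (T j x)) + 1"
        using drift[OF x] \<phi>_nonneg[OF x] by (simp flip: ennreal_plus ennreal_1)
    qed
    also have "\<dots> = (\<integral>\<^sup>+x. (\<Sum>j\<in>{1..N}. p j * \<phi> n (T j x)) \<partial>M) + 1"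
      by (subst nn_integral_add) (auto simp: emeasure_space_1)
    also have "(\<integral>\<^sup>+x. (\<Sum>j\<in>{1..N}. p j * \<phi> n (T j x)) \<partial>M) = (\<integral>\<^sup>+x. \<phi> n x \<partial>M)"
      using T stat p \<phi>_nonneg
      by (intro nn_integral_stationary_real) (auto simp: space intro: less_imp_le)
    finally show ?thesis
      using fin by (auto simp: ennreal_add_left_cancel_le)
  qed

  \<comment> \<open>The bound is uniform in \<open>n\<close>, so the truncation is removed by
    monotone convergence.\<close>
  have "(\<integral>\<^sup>+x. p g * left_log x \<partial>M) \<le> 1"
  proof -
    have "ennreal (p g * left_log x) = (SUP n. ennreal (p g * min (real n) (left_log x)))" for x
    proof (rule antisym)
      obtain n where "left_log x \<le> real n" using real_arch_simple by blast
      then show "ennreal (p g * left_log x) \<le> (SUP n. ennreal (p g * min (real n) (left_log x)))"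
        by (intro SUP_upper2[of n]) (auto simp: min_def)
      show "(SUP n. ennreal (p g * min (real n) (left_log x))) \<le> ennreal (p g * left_log x)"
        using pg by (intro SUP_least ennreal_leI) simp
    qed
    then have "(\<integral>\<^sup>+x. p g * left_log x \<partial>M)
        = (SUP n. \<integral>\<^sup>+x. p g * min (real n) (left_log x) \<partial>M)"
      using pg by (simp, intro nn_integral_monotone_convergence_SUP)
        (auto intro!: incseq_SucI le_funI ennreal_leI simp: min_def)
    also have "\<dots> \<le> 1" using bound by (intro SUP_least)
    finally show ?thesis .
  qed
  then have "ennreal (p g) * (\<integral>\<^sup>+x. left_log x \<partial>M) \<le> 1"
    using pg by (simp add: ennreal_mult' nn_integral_cmult)
  then have fin: "(\<integral>\<^sup>+x. left_log x \<partial>M) \<noteq> \<infinity>"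
    using pg by (auto simp: ennreal_mult_top top_unique)

  \<comment> \<open>A lower bound for the created amount of \<open>left_log\<close>. On the left
    only the contribution of \<open>T g\<close> is kept; on the right all maps coincide and
    \<open>left_log x\<close> is 0, so the whole image value is new.\<close>
  define D where "D x = (if x < 1/2 then p g * left_log (T g x) else left_log (2 * x - 1))" for x
  have D_meas [measurable]: "D \<in> borel_measurable M"
  proof -
    have [measurable]: "(\<lambda>x. left_log (2 * x - 1)) \<in> borel_measurable M"
      by (intro borelM) simp
    have "{x \<in> space M. x < 1/2} \<in> sets M"
      by (intro borel_measurable_less borelM) auto
    moreover have "(\<lambda>x. p g * left_log (T g x)) \<in> borel_measurable M"
      using gN by measurable
    ultimately show ?thesis unfolding D_def by (intro measurable_If) auto
  qed
  have D_nonneg: "0 \<le> D x" if "x \<in> {0..1}" for x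
    using that pg map_in_unit[of "T g" x] maps gN by (auto simp: D_def left_log_nonneg)
  have gain: "left_log x + D x \<le> (\<Sum>j\<in>{1..N}. p j * left_log (T j x))" if x: "x \<in> {0..1}" for x
  proof (cases "x < 1/2")
    case True
    have nonneg: "0 \<le> p j * left_log (T j x)" if "j \<in> {1..N}" for j
      using that p maps map_in_unit[of "T j" x] x by (auto simp: left_log_nonneg less_imp_le)
    have bad: "left_log (T b x) = l b * left_log x" if "b \<in> bad_indices N T" for b
      using l x True that by (intro left_log_bad_map) auto
    \<comment> \<open>Since \<theta> is at least 1, the bad maps alone reproduce
      \<open>left_log x\<close> on average. The index \<open>g\<close> is not bad, so its term
      \<open>D x\<close> comes on top.\<close>
    have "left_log x \<le> (\<Sum>b\<in>bad_indices N T. p b * l b) * left_log x"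
      using \<theta> x left_log_nonneg[of x] mult_right_mono[OF \<theta>, of "left_log x"] by simp
    also have "\<dots> = (\<Sum>b\<in>bad_indices N T. p b * left_log (T b x))"
      using bad by (simp add: sum_distrib_right mult.assoc)
    finally have "left_log x + D x \<le> (\<Sum>b\<in>insert g (bad_indices N T). p b * left_log (T b x))"
      using g good_indices_Int_bad_indices[of N T] True
      by (subst sum.insert) (auto simp: D_def bad_indices_def)
    also have "\<dots> \<le> (\<Sum>j\<in>{1..N}. p j * left_log (T j x))"
      using gN nonneg by (intro sum_mono2) (auto simp: bad_indices_def)
    finally show ?thesis .
  next
    case False
    have "(\<Sum>j\<in>{1..N}. p j * left_log (T j x)) = (\<Sum>j\<in>{1..N}. p j * left_log (2 * x - 1))"
      using False x maps by (intro sum.cong) (simp_all add: map_right)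
    also have "\<dots> = left_log (2 * x - 1)"
      using p1 by (simp flip: sum_distrib_right)
    finally show ?thesis using False by (simp add: D_def left_log_def)
  qed
  have "(\<integral>\<^sup>+x. left_log x \<partial>M) + (\<integral>\<^sup>+x. D x \<partial>M) = (\<integral>\<^sup>+x. ennreal (left_log x) + ennreal (D x) \<partial>M)"
    by (intro nn_integral_add[symmetric]) measurable
  also have "\<dots> \<le> (\<integral>\<^sup>+x. (\<Sum>j\<in>{1..N}. p j * left_log (T j x)) \<partial>M)"
    using gain D_nonneg left_log_nonneg
    by (intro nn_integral_mono) (auto simp: space simp flip: ennreal_plus intro!: ennreal_leI)
  also have "\<dots> = (\<integral>\<^sup>+x. left_log x \<partial>M)"
    using T stat p left_log_nonneg
    by (intro nn_integral_stationary_real) (auto simp: space intro: less_imp_le)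
  \<comment> \<open>Cancelling the integral of \<open>left_log\<close> is legitimate because it was
    shown to be finite.\<close>
  finally have "(\<integral>\<^sup>+x. D x \<partial>M) = 0"
    using fin ennreal_add_left_cancel_le[of "\<integral>\<^sup>+x. left_log x \<partial>M" "\<integral>\<^sup>+x. D x \<partial>M" 0] by simp
  then have "AE x in M. ennreal (D x) = 0"
    by (subst (asm) nn_integral_0_iff_AE) auto
  then have D0: "AE x in M. D x \<le> 0"
    by eventually_elim (auto simp: ennreal_eq_0_iff)

  \<comment> \<open>Absolute continuity enters only here: it excludes atoms, such as a point mass at
    a fixed point.\<close>
  have pt: "AE x in M. x \<noteq> a" for a :: real
  proof (cases "a \<in> {0..1}")
    case True
    have "{a} \<in> null_sets (restrict_space lborel {0..1})"
      using True by (subst null_sets_restrict_space) auto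
    then show ?thesis
      using ac by (intro AE_I'[of "{a}"]) (auto simp: absolutely_continuous_def)
  next
    case False
    then show ?thesis by (intro AE_I2) (auto simp: space)
  qed
  \<comment> \<open>What \<open>D x\<close> = 0 says off the exceptional points: \<open>T g\<close>
    sends left points to the right half, and right points lie so close to 1 that doubling the
    distance keeps them there.\<close>
  define P where "P x \<longleftrightarrow> 0 < x \<and> x < 1 \<and> (if x < 1/2 then 1/2 \<le> T g x else 3/4 \<le> x)" for x
  \<comment> \<open>\<open>left_log\<close> vanishes at 0 as well as on the right half; this
    excludes the first alternative for the image of a left point.\<close>
  have "AE x in M. T g x \<noteq> 0"
    using AE_stationary[OF _ gN pg _ stat pt[of 0]] by simp
  then have "AE x in M. P x"
    using D0 pt[of 0] pt[of 1] pt[of "1/2"] AE_space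
  proof eventually_elim
    case (elim x)
    then have x: "x \<in> {0..1}" by (simp add: space)
    then have Tx: "0 \<le> T g x" using map_in_unit[of "T g" x] maps gN by auto
    show ?case
    proof (cases "x < 1/2")
      case True
      then have "left_log (T g x) \<le> 0" using elim pg by (simp add: D_def mult_le_0_iff)
      then have "left_log (T g x) = 0" using left_log_nonneg[OF Tx] by simp
      then show ?thesis using left_log_eq_0[OF Tx] elim x True by (auto simp: P_def)
    next
      case False
      then have x': "0 \<le> 2 * x - 1" by simp
      have "left_log (2 * x - 1) = 0"
        using left_log_nonneg[OF x'] elim False by (simp add: D_def)
      then show ?thesis using left_log_eq_0[OF x'] elim x False by (auto simp: P_def)
    qed
  qed
  then have "AE x in M. P ((T g ^^ n) x)" for n
  proof (induction n)
    case (Suc n)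
    then show ?case
      using AE_stationary[OF _ gN pg _ stat, of "\<lambda>x. P ((T g ^^ n) x)"]
      by (simp add: funpow_Suc_right del: funpow.simps)
  qed simp
  then have "AE x in M. \<forall>n. P ((T g ^^ n) x)"
    by (simp add: AE_all_countable)
  then have "AE x in M. False"
  proof eventually_elim
    case (elim x)
    \<comment> \<open>The orbit is taken from its first image on, because one application of
      \<open>T g\<close> already brings a left point to the right half.\<close>
    define y where "y n = (T g ^^ Suc n) x" for n
    have P: "P (y n)" for n using elim unfolding y_def by blast
    have step: "y (Suc n) = 2 * y n - 1" if "1/2 \<le> y n" for n
      using that P[of n] maps gN map_right[of "T g" "y n"] by (auto simp: y_def P_def)
    have right: "1/2 \<le> y n" for n
    proof (induction n)
      case 0
      have "P x" using elim[rule_format, of 0] by simp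
      moreover have "T g x = 2 * x - 1" if "1/2 \<le> x" "x < 1"
        using that maps gN map_right[of "T g" x] by auto
      ultimately show ?case
        by (cases "x < 1/2") (auto simp: P_def y_def)
    next
      case (Suc n)
      then show ?case using step[of n] P[of n] by (auto simp: P_def)
    qed
    \<comment> \<open>The distance to 1 doubles forever, yet it is positive at the start and bounded
      on the right half.\<close>
    have "1 - y n = 2 ^ n * (1 - y 0)" for n
    proof (induction n)
      case (Suc n)
      then show ?case using step[OF right[of n]] by simp
    qed simp
    then have "2 ^ n * (1 - y 0) \<le> 1" for n using right[of n] by (simp add: algebra_simps)
    moreover have "0 < 1 - y 0" using P[of 0] by (simp add: P_def)
    moreover obtain n where "1 / (1 - y 0) < 2 ^ n"
      using real_arch_pow[of 2 "1 / (1 - y 0)"] by auto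
    ultimately show ?case
      by (metis linorder_not_less pos_divide_less_eq)
  qed
  then show False by (simp add: AE_False)
qed

theorem theorem1p1:
  fixes N :: nat
    and T :: "nat \<Rightarrow> real \<Rightarrow> real"
    and p :: "nat \<Rightarrow> real"
    and l :: "nat \<Rightarrow> real"
    and \<theta> :: real
  assumes "\<forall>j\<in>{1..N}. good_map (T j) \<or> bad_map (T j)"
    and "good_indices N T \<noteq> {}"
    and "bad_indices N T \<noteq> {}"
    and "\<forall>b\<in>bad_indices N T. bad_map_with (l b) (T b)"
    and "\<forall>j\<in>{1..N}. p j > 0"
    and "(\<Sum>j\<in>{1..N}. p j) = 1"
    and "\<theta> = (\<Sum>b\<in>bad_indices N T. p b * l b)"
    and "\<theta> \<ge> 1"
  shows "\<not> (\<exists>\<mu>. acs_measure N T p \<mu> \<and> prob_space \<mu>)"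
proof
  assume "\<exists>\<mu>. acs_measure N T p \<mu> \<and> prob_space \<mu>"
  then obtain \<mu> where \<mu>: "acs_measure N T p \<mu>" "prob_space \<mu>" by blast
  have sets: "sets \<mu> = sets (restrict_space borel {0..1})"
    using \<mu>(1) by (simp add: acs_measure_def)
  have "space \<mu> = {0..1}"
    using sets_eq_imp_space_eq[OF sets] by (simp add: space_restrict_space)
  then have stat: "(\<Sum>j\<in>{1..N}. ennreal (p j) * emeasure \<mu> (T j -` A \<inter> space \<mu>)) = emeasure \<mu> A"
    if "A \<in> sets \<mu>" for A
    using \<mu>(1) that sets by (simp add: acs_measure_def)
  obtain g where "g \<in> good_indices N T" using assms(2) by blast
  from unit_measure_not_stationary[OF \<mu>(2) sets _ assms(1) this assms(4-6) _ stat]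
  show False using \<mu>(1) assms(7,8) by (simp add: acs_measure_def)
qed

end
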